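(* Let $S=k[x_1,\ldots,x_n]$ be a polynomial ring over a field $k$. Let $u,v\in\mathrm{Mon}_d(S)$ (with $u\geq_{lex}v$), $x_1\mid u$, be such that $I=(\mathcal L(u,v))$ is a completely lexsegment ideal of $S$ which is not an initial lexsegment ideal. Let $j$ be the exponent of the variable $x_n$ in $v$ and $a=|\mathrm{Mon}_d(S)\setminus\mathcal L^i(u)|$. The following statements are equivalent: (a) $I$ is a Gotzmann ideal. (b) $a\geq\binom{n+d-1}{d}-(j+1)$.
   Context: $\mathrm{Mon}_d(S)$ is the set of monomials of degree $d$ of $S$; monomials are ordered by the lexicographic order with $x_1>\cdots>x_n$. For $u\geq_{lex}v$ in $\mathrm{Mon}_d(S)$, $\mathcal L(u,v)=\{w\in\mathrm{Mon}_d(S): u\geq_{lex}w\geq_{lex}v\}$ is the lexsegment set determined by $u,v$, and $\mathcal L^i(u)=\{w\in\mathrm{Mon}_d(S): w\geq_{lex}u\}$ is the initial lexsegment; an initial lexsegment ideal is one generated by an initial lexsegment. The shadow of a set $L$ of monomials is $\{x_1,\ldots,x_n\}L$. A lexsegment set is a completely lexsegment set if all its iterated shadows are lexsegment sets; the ideal it generates is then a completely lexsegment ideal. For a graded ideal $I$, $I^{lex}$ denotes the unique lexicographic ideal with the same Hilbert function as $I$ (each component $(I^{lex})_j$ is spanned by the initial lexsegment of degree $j$ of cardinality $\dim_kI_j$). A graded ideal $I$ generated in degree $d$ is Gotzmann if the number of generators of $(x_1,\ldots,x_n)I$ is the smallest possible, i.e. equals the number of generators of $(x_1,\ldots,x_n)(I^{lex})_{\langle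 d\rangle}$, where $(I^{lex})_{\langle d\rangle}$ is the ideal generated by $(I^{lex})_d$; equivalently, $I$ and $(I^{lex})_{\langle d\rangle}$ have the same Hilbert function. *)

theory Defs
  imports Complex_Main "HOL-Library.Poly_Mapping" "HOL-Library.Cardinality"
begin

(* The variables x_1, ..., x_n are indexed by a finite linearly ordered type 'n with
   n = CARD('n); the least index is that of x_1, the greatest that of x_n. *)

type_synonym 'n monom = "'n \<Rightarrow>\<^sub>0 nat"
type_synonym ('n, 'k) mpoly = "('n \<Rightarrow>\<^sub>0 nat) \<Rightarrow>\<^sub>0 'k"

definition first_var :: "'n::{finite,linorder}"
  where "first_var = Min UNIV"

definition last_var :: "'n::{finite,linorder}"
  where "last_var = Max UNIV"

definition mdeg :: "'n::finite monom \<Rightarrow> nat"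
  where "mdeg w = (\<Sum>i\<in>UNIV. Poly_Mapping.lookup w i)"

definition Mon :: "nat \<Rightarrow> 'n::finite monom set"
  where "Mon d = {w. mdeg w = d}"

(* The library order on 'n monom compares exponents at the least index where they differ,
   which is the lexicographic order with x_1 > ... > x_n. *)

lemma monom_less_iff_lex:
  fixes v w :: "'n::linorder monom"
  shows "v < w \<longleftrightarrow> (\<exists>i. Poly_Mapping.lookup v i < Poly_Mapping.lookup w i \<and>
    (\<forall>l<i. Poly_Mapping.lookup v l = Poly_Mapping.lookup w l))"
  by (simp add: less_poly_mapping.rep_eq less_fun_def)

definition lexsegment :: "nat \<Rightarrow> 'n::{finite,linorder} monom \<Rightarrow> 'n monom \<Rightarrow> 'n monom set"
  where "lexsegment d u v = {w \<in> Mon d. u \<ge> w \<and> w \<ge> v}"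

definition init_lexsegment :: "nat \<Rightarrow> 'n::{finite,linorder} monom \<Rightarrow> 'n monom set"
  where "init_lexsegment d u = {w \<in> Mon d. w \<ge> u}"

definition is_lexsegment_set :: "nat \<Rightarrow> 'n::{finite,linorder} monom set \<Rightarrow> bool"
  where "is_lexsegment_set d L \<longleftrightarrow> (\<exists>u\<in>Mon d. \<exists>v\<in>Mon d. u \<ge> v \<and> L = lexsegment d u v)"

(* Monomials are exponent vectors, so their product is written additively. *)

definition shadow :: "'n monom set \<Rightarrow> 'n monom set"
  where "shadow L = {Poly_Mapping.single i 1 + w | i w. w \<in> L}"

definition completely_lexsegment_set :: "nat \<Rightarrow> 'n::{finite,linorder} monom set \<Rightarrow> bool"
  where "completely_lexsegment_set d L \<longleftrightarrow> (\<forall>i. is_lexsegment_set (d + i) ((shadow ^^ i) L))"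

(* The ideal generated by A is ideal.span A. *)

global_interpretation ideal: module "(*) :: 'a::comm_ring_1 \<Rightarrow> 'a \<Rightarrow> 'a"
  by unfold_locales (simp_all add: algebra_simps)

definition scalar_mult :: "'k::field \<Rightarrow> ('n, 'k) mpoly \<Rightarrow> ('n, 'k) mpoly"
  where "scalar_mult c p = Poly_Mapping.single 0 c * p"

global_interpretation kspace: vector_space "scalar_mult :: 'k::field \<Rightarrow> ('n, 'k) mpoly \<Rightarrow> _"
proof unfold_locales
  fix a b :: 'k and p q :: "('n, 'k) mpoly"
  show "scalar_mult a (p + q) = scalar_mult a p + scalar_mult a q"
    by (simp add: scalar_mult_def distrib_left)
  show "scalar_mult (a + b) p = scalar_mult a p + scalar_mult b p"
    by (simp add: scalar_mult_def single_add distrib_right)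
  show "scalar_mult a (scalar_mult b p) = scalar_mult (a * b) p"
    by (simp add: scalar_mult_def mult_single flip: mult.assoc)
  show "scalar_mult 1 p = p"
    by (simp add: scalar_mult_def)
qed

definition mpoly_of :: "'n monom \<Rightarrow> ('n, 'k::field) mpoly"
  where "mpoly_of w = Poly_Mapping.single w 1"

definition monomial_ideal :: "'n monom set \<Rightarrow> ('n, 'k::field) mpoly set"
  where "monomial_ideal L = ideal.span (mpoly_of ` L)"

definition init_lexsegment_ideal :: "('n::{finite,linorder}, 'k::field) mpoly set \<Rightarrow> bool"
  where "init_lexsegment_ideal I \<longleftrightarrow>
    (\<exists>d. \<exists>u\<in>Mon d. I = monomial_ideal (init_lexsegment d u))"

definition completely_lexsegment_ideal :: "('n::{finite,linorder}, 'k::field) mpoly set \<Rightarrow> bool"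
  where "completely_lexsegment_ideal I \<longleftrightarrow>
    (\<exists>d L. completely_lexsegment_set d L \<and> I = monomial_ideal L)"

definition hom_component :: "nat \<Rightarrow> ('n::finite, 'k::field) mpoly set \<Rightarrow> ('n, 'k) mpoly set"
  where "hom_component j I = {p \<in> I. Poly_Mapping.keys p \<subseteq> Mon j}"

definition hilbert_function :: "('n::finite, 'k::field) mpoly set \<Rightarrow> nat \<Rightarrow> nat"
  where "hilbert_function I j = kspace.dim (hom_component j I)"

(* The m lexicographically greatest monomials of degree j (for m at most |Mon_j|),
   i.e. the initial lexsegment of degree j with m elements; empty for m = 0. *)

definition init_lexsegment_of_card :: "nat \<Rightarrow> nat \<Rightarrow> 'n::{finite,linorder} monom set"
  where "init_lexsegment_of_card j m = {w \<in> Mon j. card {w' \<in> Mon j. w' > w} < m}"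

(* The graded k-subspace whose component in each degree j is spanned by the initial
   lexsegment of cardinality dim_k I_j. For a graded ideal I, Macaulay's theorem says that
   it is an ideal. *)

definition lex_ideal :: "('n::{finite,linorder}, 'k::field) mpoly set \<Rightarrow> ('n, 'k) mpoly set"
  where "lex_ideal I =
    kspace.span (\<Union>j. mpoly_of ` init_lexsegment_of_card j (hilbert_function I j))"

(* Ideals satisfying this are automatically graded. *)

definition generated_in_degree :: "nat \<Rightarrow> ('n::finite, 'k::field) mpoly set \<Rightarrow> bool"
  where "generated_in_degree d I \<longleftrightarrow> I = ideal.span (hom_component d I)"

definition irrelevant_ideal :: "('n, 'k::field) mpoly set"
  where "irrelevant_ideal = ideal.span (range (\<lambda>i. mpoly_of (Poly_Mapping.single i 1)))"

definition ideal_mult :: "'a::comm_ring_1 set \<Rightarrow> 'a set \<Rightarrow> 'a set"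
  where "ideal_mult I J = ideal.span {f * g | f g. f \<in> I \<and> g \<in> J}"

(* The minimal number of generators of a finitely generated ideal. *)

definition num_generators :: "'a::comm_ring_1 set \<Rightarrow> nat"
  where "num_generators J = (LEAST m. \<exists>G. finite G \<and> card G = m \<and> ideal.span G = J)"

definition gotzmann_ideal :: "nat \<Rightarrow> ('n::{finite,linorder}, 'k::field) mpoly set \<Rightarrow> bool"
  where "gotzmann_ideal d I \<longleftrightarrow> generated_in_degree d I \<and>
    num_generators (ideal_mult irrelevant_ideal I) =
    num_generators (ideal_mult irrelevant_ideal (ideal.span (hom_component d (lex_ideal I))))"

end

theory Submission
  imports Defs
begin

text \<open>
  Write \<open>L = \<L>(u,v)\<close>, let \<open>B\<close> be the initial lexsegment of all monomials \<open>\<ge> v\<close>, and let \<open>m\<close> be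
  the number of monomials of degree \<open>d\<close> that are \<open>> u\<close>, so \<open>|B| = |L| + m\<close>.  Let \<open>A\<close> be the initial
  lexsegment with \<open>|A| = |L|\<close>; then \<open>C = B - A\<close> consists of the \<open>m\<close> smallest monomials \<open>\<ge> v\<close>.  Since
  \<open>I\<close> and the lexicographic ideal are monomial, being a Gotzmann ideal means that \<open>L\<close> and \<open>A\<close> have
  shadows of the same size (\<open>gotzmann_ideal_monomial_ideal\<close>).

  Two computations decide when this happens.  The shadow of \<open>L\<close> is a lexsegment, hence it is the one
  from \<open>x\<^sub>1 u\<close> down to \<open>x\<^sub>n v\<close>; the shadow of \<open>B\<close> contains in addition only the products of \<open>x\<^sub>1\<close> with
  the \<open>m\<close> monomials above \<open>u\<close>, so it is larger by \<open>m\<close> (\<open>card_shadow_init_lexsegment\<close>).  The shadow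
  of \<open>A\<close>, on the other hand, is compared with that of \<open>B\<close> through the map that divides a monomial by
  its variable of greatest index: for an initial lexsegment, the shadow is the full preimage under
  this map, and the fibre over \<open>c\<close> contains \<open>x\<^sub>n c\<close> and is a singleton exactly if \<open>x\<^sub>n\<close> divides \<open>c\<close>.
  Hence \<open>I\<close> is Gotzmann if and only if \<open>x\<^sub>n\<close> divides all elements of \<open>C\<close> (\<open>card_shadow_eq_iff\<close>).

  Finally, the smallest monomials \<open>\<ge> v\<close> are \<open>v\<close>, \<open>v x\<^bsub>n-1\<^esub>/x\<^sub>n\<close>, \<open>v x\<^bsub>n-1\<^esub>\<^sup>2/x\<^sub>n\<^sup>2\<close>, ..., and the exponent
  of \<open>x\<^sub>n\<close> drops by one at each step, starting from \<open>j\<close>.  So all elements of \<open>C\<close> are divisible by \<open>x\<^sub>n\<close>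
  if and only if \<open>m \<le> j\<close> (\<open>card_last_interval_iff\<close>).  As \<open>a + m + 1\<close> is the number of all monomials
  of degree \<open>d\<close>, this is the numerical condition.
\<close>

abbreviation expo :: "'n monom \<Rightarrow> 'n \<Rightarrow> nat" where
  "expo \<equiv> Poly_Mapping.lookup"

abbreviation var :: "'n \<Rightarrow> 'n monom" where "var i \<equiv> Poly_Mapping.single i 1"

section \<open>Monomials of a fixed degree\<close>

lemma first_var_le: "first_var \<le> i"
  by (simp add: first_var_def)

lemma le_last_var: "i \<le> last_var"
  by (simp add: last_var_def)

lemma mdeg_add: "mdeg (v + w) = mdeg v + mdeg w"
  by (simp add: mdeg_def lookup_add sum.distrib)

lemma mdeg_single: "mdeg (Poly_Mapping.single i s) = s"
  by (simp add: mdeg_def lookup_single when_def)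

lemma mdeg_eq_0_iff: "mdeg w = 0 \<longleftrightarrow> w = 0"
  by (auto simp: mdeg_def intro: poly_mapping_eqI)

lemma var_le_var_iff: "var i \<le> var k \<longleftrightarrow> k \<le> i"
proof -
  have less: "var i < var k" if "k < i" for i k :: "'a::linorder"
    unfolding monom_less_iff_lex using that
    by (intro exI[of _ k]) (auto simp: lookup_single when_def)
  show ?thesis
    using less[of i k] less[of k i] by (cases i k rule: linorder_cases) auto
qed

lemma var_dvd_monom:
  assumes "0 < expo w i"
  shows "w = var i + (w - var i)"
  using assms by (intro poly_mapping_eqI) (auto simp: lookup_add lookup_minus lookup_single when_def)

lemma shadow_subset_Mon: "L \<subseteq> Mon d \<Longrightarrow> shadow L \<subseteq> Mon (Suc d)"
  by (auto simp: shadow_def Mon_def mdeg_add mdeg_single)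

text \<open>Listing the exponents turns monomials of degree \<open>d\<close> into lists with sum \<open>d\<close>, which are counted by
  stars and bars.\<close>

definition exponent_vector :: "'n::{finite,linorder} monom \<Rightarrow> nat list" where
  "exponent_vector w = map (expo w) (sorted_list_of_set UNIV)"

lemma bij_betw_exponent_vector:
  "bij_betw (exponent_vector :: 'n::{finite,linorder} monom \<Rightarrow> _) (Mon d)
     {l. length l = CARD('n) \<and> sum_list l = d}"
proof -
  let ?xs = "sorted_list_of_set (UNIV :: 'n set)"
  have sum: "sum_list (map f ?xs) = sum f UNIV" for f :: "'n \<Rightarrow> nat"
    by (simp add: sum_list_distinct_conv_sum_set)
  show ?thesis
  proof (rule bij_betwI')
    fix v w :: "'n monom"
    show "exponent_vector v = exponent_vector w \<longleftrightarrow> v = w"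
      by (auto simp: exponent_vector_def intro: poly_mapping_eqI)
    assume "v \<in> Mon d"
    then show "exponent_vector v \<in> {l. length l = CARD('n) \<and> sum_list l = d}"
      by (simp add: exponent_vector_def Mon_def mdeg_def sum)
  next
    fix l :: "nat list" assume "l \<in> {l. length l = CARD('n) \<and> sum_list l = d}"
    then have l: "length l = length ?xs" "sum_list l = d" by auto
    define f where "f x = the (map_of (zip ?xs l) x)" for x
    have f: "map f ?xs = l"
      using l(1) by (intro nth_equalityI) (auto simp: f_def map_of_zip_nth)
    define w where "w = Abs_poly_mapping f"
    have "expo w = f" by (simp add: w_def)
    then have "exponent_vector w = l" "w \<in> Mon d"
      using f l(2) sum[of f] by (auto simp: exponent_vector_def Mon_def mdeg_def)
    then show "\<exists>w\<in>Mon d. l = exponent_vector (w :: 'n monom)" by blast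
  qed
qed

lemma card_Mon: "card (Mon d :: 'n::{finite,linorder} monom set) = (CARD('n) + d - 1) choose d"
proof -
  have "card (Mon d :: 'n monom set) = (d + CARD('n) - 1) choose d"
    using bij_betw_same_card[OF bij_betw_exponent_vector, of d] by (simp add: card_length_sum_list)
  then show ?thesis by (simp add: add.commute)
qed

lemma finite_Mon: "finite (Mon d :: 'n::{finite,linorder} monom set)"
proof -
  have "0 < card (Mon d :: 'n monom set)"
    unfolding card_Mon
    by (intro zero_less_binomial) (use zero_less_card_finite[where 'a='n] in linarith)
  then show ?thesis by (rule card_ge_0_finite)
qed

section \<open>Shadows of initial segments\<close>

text \<open>In contrast to an initial lexsegment given by its least element, an initial segment may be empty;
  the notion covers both \<open>init_lexsegment\<close> and \<open>init_lexsegment_of_card\<close>.\<close>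

definition initial_segment :: "nat \<Rightarrow> 'n::{finite,linorder} monom set \<Rightarrow> bool" where
  "initial_segment d A \<longleftrightarrow> A \<subseteq> Mon d \<and> (\<forall>a\<in>A. \<forall>b\<in>Mon d. a \<le> b \<longrightarrow> b \<in> A)"

text \<open>The variable of greatest index is the least variable of \<open>w\<close> in the monomial order.  For \<open>w = 1\<close>,
  where there is none, the value is meaningless.\<close>

definition remove_max_var :: "'n::linorder monom \<Rightarrow> 'n monom" where
  "remove_max_var w = w - var (Max (Poly_Mapping.keys w))"

lemma monom_eq_var_plus_remove_max_var:
  assumes "w \<noteq> 0"
  shows "w = var (Max (Poly_Mapping.keys w)) + remove_max_var w"
proof -
  have "Max (Poly_Mapping.keys w) \<in> Poly_Mapping.keys w"
    using assms by (intro Max_in) auto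
  then show ?thesis
    unfolding remove_max_var_def by (intro var_dvd_monom) (simp add: in_keys_iff)
qed

lemma remove_max_var_var_plus:
  assumes "\<And>k. 0 < expo w k \<Longrightarrow> k \<le> i"
  shows "remove_max_var (var i + w) = w"
proof -
  have "Max (Poly_Mapping.keys (var i + w)) = i"
    by (rule Max_eqI)
       (use assms in \<open>auto simp: in_keys_iff lookup_add lookup_single when_def split: if_splits\<close>)
  then show ?thesis
    by (simp add: remove_max_var_def)
qed

text \<open>Dividing by the least variable leaves the greatest quotient.\<close>

lemma le_remove_max_var: "w \<le> remove_max_var (var i + w)"
proof -
  let ?k = "Max (Poly_Mapping.keys (var i + w))"
  have nz: "var i + w \<noteq> 0"
    by (metis add_eq_0_iff_both_eq_0 lookup_single_eq lookup_zero zero_neq_one zero_eq_add_iff_both_eq_0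
        lookup_add)
  have "i \<le> ?k"
    by (rule Max_ge) (auto simp: in_keys_iff lookup_add)
  then have le: "var ?k \<le> var i" by (simp only: var_le_var_iff)
  have eq: "var i + w = var ?k + remove_max_var (var i + w)"
    by (rule monom_eq_var_plus_remove_max_var[OF nz])
  show ?thesis
  proof (rule ccontr)
    assume "\<not> ?thesis"
    then have "var ?k + remove_max_var (var i + w) < var i + w"
      using le by (intro add_le_less_mono) auto
    with eq show False by simp
  qed
qed

text \<open>If some quotient of \<open>w\<close> by a variable lies in an initial segment, then so does the greatest one.\<close>

lemma shadow_initial_segment:
  assumes "initial_segment d A"
  shows "shadow A = {w \<in> Mon (Suc d). remove_max_var w \<in> A}"
proof (intro set_eqI iffI)
  fix w assume "w \<in> shadow A"
  then obtain i a where a: "a \<in> A" and w: "w = var i + a" by (auto simp: shadow_def)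
  have wd: "w \<in> Mon (Suc d)"
    using a assms by (auto simp: w initial_segment_def Mon_def mdeg_add mdeg_single)
  then have "w \<noteq> 0" by (auto simp: Mon_def mdeg_def)
  from arg_cong[OF monom_eq_var_plus_remove_max_var[OF this], of mdeg]
  have "remove_max_var w \<in> Mon d"
    using wd by (simp add: Mon_def mdeg_add mdeg_single)
  with a le_remove_max_var[of a i] assms wd show "w \<in> {w \<in> Mon (Suc d). remove_max_var w \<in> A}"
    by (auto simp: initial_segment_def w)
next
  fix w assume w: "w \<in> {w \<in> Mon (Suc d). remove_max_var w \<in> A}"
  then have "w \<noteq> 0" by (auto simp: Mon_def mdeg_def)
  from monom_eq_var_plus_remove_max_var[OF this] w show "w \<in> shadow A"
    unfolding shadow_def by blast
qed

text \<open>The difference of the shadows is the preimage of \<open>B - A\<close> under \<open>remove_max_var\<close>.  The fibre over \<open>c\<close>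
  contains \<open>x\<^sub>n c\<close>, so the preimage has at least \<open>|B - A|\<close> elements.  If \<open>x\<^sub>n\<close> divides \<open>c\<close>, nothing else
  lies in the fibre; otherwise \<open>x\<^sub>k c\<close> does as well, where \<open>k < n\<close> is the greatest index of a variable
  of \<open>c\<close>; such a variable exists since \<open>c\<close> has positive degree.\<close>

lemma card_shadow_eq_iff:
  assumes A: "initial_segment d A" and B: "initial_segment d B" and "A \<subseteq> B" and "0 < d"
  shows "card (shadow B) = card (shadow A) + card (B - A)
     \<longleftrightarrow> (\<forall>c\<in>B - A. 0 < expo c last_var)"
proof -
  let ?S = "shadow B - shadow A"
  let ?T = "(+) (var last_var) ` (B - A)"
  have S: "?S = {w \<in> Mon (Suc d). remove_max_var w \<in> B - A}"
    by (auto simp: shadow_initial_segment[OF A] shadow_initial_segment[OF B])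
  have deg: "c \<in> Mon d" if "c \<in> B" for c using that B by (auto simp: initial_segment_def)
  have fin: "finite (shadow B)"
    by (rule finite_subset[OF _ finite_Mon]) (use B in \<open>auto simp: shadow_initial_segment\<close>)
  have AB: "shadow A \<subseteq> shadow B" using \<open>A \<subseteq> B\<close> by (auto simp: shadow_def)
  have T: "?T \<subseteq> ?S"
    using deg by (auto simp: S remove_max_var_var_plus le_last_var Mon_def mdeg_add mdeg_single
        simp del: One_nat_def)
  have card_T: "card ?T = card (B - A)" by (rule card_image) simp
  have "card (shadow B) = card (shadow A) + card ?S"
    using fin AB by (metis card_Diff_subset card_mono finite_subset le_add_diff_inverse)
  then have "card (shadow B) = card (shadow A) + card (B - A) \<longleftrightarrow> card ?T = card ?S"
    using card_T by auto
  also have "\<dots> \<longleftrightarrow> ?T = ?S"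
    using T fin by (metis card_subset_eq finite_Diff)
  also have "\<dots> \<longleftrightarrow> (\<forall>c\<in>B - A. 0 < expo c last_var)"
  proof
    assume TS: "?T = ?S"
    show "\<forall>c\<in>B - A. 0 < expo c last_var"
    proof (rule ballI, rule ccontr)
      fix c assume c: "c \<in> B - A" and "\<not> 0 < expo c last_var"
      then have c0: "expo c last_var = 0" by simp
      define k where "k = Max (Poly_Mapping.keys c)"
      have "c \<noteq> 0" using deg[of c] c \<open>0 < d\<close> by (auto simp: Mon_def mdeg_def)
      then have "k \<in> Poly_Mapping.keys c" unfolding k_def by (intro Max_in) auto
      then have "k \<noteq> last_var" using c0 by (auto simp: in_keys_iff)
      have "remove_max_var (var k + c) = c"
        by (rule remove_max_var_var_plus) (auto simp: k_def in_keys_iff)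
      then have "var k + c \<in> ?S"
        using c deg[of c] by (auto simp: S Mon_def mdeg_add mdeg_single)
      then obtain b where "var k + c = var last_var + b" using TS by blast
      then have "expo (var k + c) last_var = expo (var last_var + b) last_var" by simp
      then show False
        using c0 \<open>k \<noteq> last_var\<close> by (simp add: lookup_add lookup_single)
    qed
  next
    assume all: "\<forall>c\<in>B - A. 0 < expo c last_var"
    have "w \<in> ?T" if "w \<in> ?S" for w
    proof -
      from that have w: "w \<in> Mon (Suc d)" "remove_max_var w \<in> B - A" by (simp_all add: S)
      then have "w \<noteq> 0" by (auto simp: Mon_def mdeg_def)
      note eq = monom_eq_var_plus_remove_max_var[OF this]
      have "0 < expo w last_var"
        using all w(2) by (subst eq) (auto simp: lookup_add)
      then have "last_var \<in> Poly_Mapping.keys w" by (simp add: in_keys_iff)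
      then have "Max (Poly_Mapping.keys w) = last_var"
        by (intro Max_eqI) (auto simp: le_last_var)
      with eq w(2) show ?thesis by (metis imageI)
    qed
    with T show "?T = ?S" by blast
  qed
  finally show ?thesis .
qed

text \<open>The number of greater elements is a bijection from \<open>X\<close> to \<open>{..<card X}\<close>.\<close>

lemma card_top_elements:
  fixes X :: "'a::linorder set"
  assumes "finite X" and "k \<le> card X"
  shows "card {w \<in> X. card {w' \<in> X. w' > w} < k} = k"
proof -
  let ?r = "\<lambda>w. card {w' \<in> X. w' > w}"
  have less: "?r w < ?r v" if "v < w" "w \<in> X" for v w
    using assms(1) that by (intro psubset_card_mono) auto
  have inj: "inj_on ?r X"
  proof (rule inj_onI)
    fix v w assume "v \<in> X" "w \<in> X" "?r v = ?r w"
    then show "v = w" using less[of v w] less[of w v] by (cases v w rule: linorder_cases) auto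
  qed
  have "?r ` X \<subseteq> {..<card X}"
    using assms(1) by (auto intro!: psubset_card_mono)
  then have img: "?r ` X = {..<card X}"
    by (intro card_subset_eq) (auto simp: card_image[OF inj])
  have "?r ` {w \<in> X. ?r w < k} = {..<k}"
  proof -
    have "?r ` {w \<in> X. ?r w < k} = {i \<in> ?r ` X. i < k}" by blast
    then show ?thesis using img assms(2) by auto
  qed
  then show ?thesis
    using card_image[OF inj_on_subset[OF inj, of "{w \<in> X. ?r w < k}"]] by simp
qed

lemma initial_segment_init_lexsegment: "initial_segment d (init_lexsegment d v)"
  by (auto simp: initial_segment_def init_lexsegment_def)

lemma initial_segment_init_lexsegment_of_card: "initial_segment d (init_lexsegment_of_card d k)"
  unfolding initial_segment_def init_lexsegment_of_card_def
proof (safe)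
  fix a b :: "'a monom" assume *: "card {w' \<in> Mon d. a < w'} < k" "a \<le> b"
  have "card {w' \<in> Mon d. b < w'} \<le> card {w' \<in> Mon d. a < w'}"
    using *(2) by (intro card_mono) (auto simp: finite_Mon)
  with *(1) show "card {w' \<in> Mon d. b < w'} < k" by simp
qed

text \<open>Initial segments of the same degree form a chain under inclusion.\<close>

lemma initial_segment_subset_of_card_le:
  assumes A: "initial_segment d A" and B: "initial_segment d B" and "card A \<le> card B"
  shows "A \<subseteq> B"
proof (rule ccontr)
  assume "\<not> A \<subseteq> B"
  then obtain a where a: "a \<in> A" "a \<notin> B" by blast
  have "B \<subseteq> A"
  proof
    fix b assume "b \<in> B"
    then have "a \<le> b" using a A B unfolding initial_segment_def by (meson linear subsetD)
    then show "b \<in> A" using a(1) A B \<open>b \<in> B\<close> unfolding initial_segment_def by blast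
  qed
  with a have "B \<subset> A" by blast
  moreover have "finite A" using A finite_Mon finite_subset by (auto simp: initial_segment_def)
  ultimately show False using assms(3) psubset_card_mono by (metis not_le)
qed

section \<open>The smallest monomials above a given one\<close>

text \<open>If two monomials have the same exponents in the first variables, then so does everything between
  them.\<close>

lemma expo_eq_between:
  fixes a b w :: "'n::linorder monom"
  assumes "a \<le> w" and "w \<le> b" and eq: "\<And>i. i < k \<Longrightarrow> expo a i = expo b i" and "i < k"
  shows "expo w i = expo a i"
proof (cases "a = w \<or> w = b")
  case False
  with assms(1,2) obtain m m' where m: "expo a m < expo w m" "\<forall>l<m. expo a l = expo w l"
    and m': "expo w m' < expo b m'" "\<forall>l<m'. expo w l = expo b l"
    using monom_less_iff_lex[of a w] monom_less_iff_lex[of w b] by auto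
  have "k \<le> m"
  proof (rule ccontr)
    assume "\<not> k \<le> m"
    then have "m < k" by simp
    then show False
      using m m' eq[of m] eq[of m'] less_trans[of m' m k]
      by (cases m m' rule: linorder_cases) auto
  qed
  with m \<open>i < k\<close> show ?thesis by simp
qed (use assms in auto)

text \<open>Here \<open>C\<close> is empty or an interval of monomials starting at \<open>v\<close>.  Let \<open>j\<close> be the exponent of \<open>x\<^sub>n\<close> in \<open>v\<close> and
  \<open>p\<^sub>s = v x\<^bsub>n-1\<^esub>\<^sup>s / x\<^sub>n\<^sup>s\<close>.  The monomials between \<open>v = p\<^sub>0\<close> and \<open>p\<^sub>j\<close> are exactly \<open>p\<^sub>0 < ... < p\<^sub>j\<close>, since they
  differ from \<open>v\<close> only in the last two exponents, whose sum is fixed.  Among them only \<open>p\<^sub>j\<close> is not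
  divisible by \<open>x\<^sub>n\<close>.  So \<open>C\<close> contains a monomial not divisible by \<open>x\<^sub>n\<close> exactly if it reaches \<open>p\<^sub>j\<close>,
  that is, if it has at least \<open>j + 1\<close> elements.  The assumption on the variables says that \<open>n \<ge> 2\<close>,
  so that \<open>x\<^bsub>n-1\<^esub>\<close> exists.\<close>

lemma card_last_interval_iff:
  fixes v :: "'n::{finite,linorder} monom"
  assumes v: "v \<in> Mon d"
    and A: "initial_segment d A"
    and vars: "(first_var :: 'n) \<noteq> last_var"
  defines "C \<equiv> init_lexsegment d v - A"
  shows "(\<forall>c\<in>C. 0 < expo c last_var) \<longleftrightarrow> card C \<le> expo v last_var"
proof -
  let ?l = "last_var :: 'n"
  define j where "j = expo v ?l"
  \<comment> \<open>\<open>k\<close> is the index of the last variable but one.\<close>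
  define k :: 'n where "k = Max (UNIV - {?l})"
  have "first_var \<in> UNIV - {?l}" using vars by simp
  then have "k \<in> UNIV - {?l}" unfolding k_def by (intro Max_in) auto
  then have kl: "k < ?l" using le_last_var[of k] by auto
  then have neq: "k \<noteq> ?l" "?l \<noteq> k" by auto
  have ltl: "i \<le> k" if "i < ?l" for i using that by (auto simp: k_def)
  define p where "p s = v + Poly_Mapping.single k s - Poly_Mapping.single ?l s" for s
  have expo_p: "expo (p s) i =
      (if i = k then expo v i + s else if i = ?l then j - s else expo v i)" if "s \<le> j" for s i
    using that neq by (auto simp: p_def j_def lookup_add lookup_minus lookup_single when_def)
  have p_add: "p s + Poly_Mapping.single ?l s = v + Poly_Mapping.single k s" if "s \<le> j" for s
    using that kl
    by (intro poly_mapping_eqI)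
       (auto simp: p_def j_def lookup_add lookup_minus lookup_single when_def)
  have p_Mon: "p s \<in> Mon d" if "s \<le> j" for s
    using arg_cong[OF p_add[OF that], of mdeg] v by (simp add: Mon_def mdeg_add mdeg_single)
  have p_mono: "p s < p t" if "s < t" "t \<le> j" for s t
    unfolding monom_less_iff_lex
    using that kl by (intro exI[of _ k]) (auto simp: expo_p)
  have p0: "p 0 = v" by (simp add: p_def)
  have p_le: "p s \<le> p t" if "s \<le> t" "t \<le> j" for s t
    using p_mono[of s t] that by (cases "s = t") auto
  have pj_last: "expo (p j) ?l = 0" using neq by (simp add: expo_p)
  have interval: "w \<in> p ` {..j}" if w: "w \<in> Mon d" "v \<le> w" "w \<le> p j" for w
  proof -
    have eq: "expo w i = expo v i" if "i < k" for i
      by (rule expo_eq_between[OF w(2,3) _ that]) (use kl in \<open>auto simp: expo_p\<close>)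
    have ge: "expo v k \<le> expo w k"
    proof (cases "v = w")
      case False
      then obtain i where i: "expo v i < expo w i" "\<forall>l<i. expo v l = expo w l"
        using w(2) monom_less_iff_lex[of v w] by auto
      then have "k \<le> i" using eq by (metis less_irrefl not_le)
      then show ?thesis using i by (cases "k = i") auto
    qed simp
    have deg: "mdeg x = (\<Sum>i\<in>{..<k}. expo x i) + expo x k + expo x ?l" for x :: "'n monom"
    proof -
      have "(UNIV :: 'n set) = insert ?l (insert k {..<k})"
        using ltl le_last_var by (force simp: less_le)
      then have "mdeg x = sum (expo x) (insert ?l (insert k {..<k}))"
        by (simp add: mdeg_def)
      then show ?thesis using kl neq by simp
    qed
    have "expo w k + expo w ?l = expo v k + j"
      using w(1) v deg[of w] deg[of v] eq by (simp add: Mon_def j_def)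
    moreover have "i < k \<or> i = k \<or> i = ?l" for i
      using ltl[of i] le_last_var[of i] by force
    ultimately have "expo w i = expo (p (j - expo w ?l)) i" for i
      using ge eq[of i] neq kl by (auto simp: expo_p)
    then have "w = p (j - expo w ?l)" by (rule poly_mapping_eqI)
    then show ?thesis by (metis atMost_iff diff_le_self imageI)
  qed
  have C: "c \<in> C \<longleftrightarrow> c \<in> Mon d \<and> v \<le> c \<and> c \<notin> A" for c
    by (auto simp: C_def init_lexsegment_def)
  have C_down: "b \<in> C" if "c \<in> C" "b \<in> Mon d" "v \<le> b" "b \<le> c" for b c
    using that A by (auto simp: C initial_segment_def)
  have inj: "inj_on p {..j}"
    by (rule inj_onI) (metis atMost_iff less_irrefl linorder_neqE_nat p_mono)
  have fin: "finite C" by (rule finite_subset[OF _ finite_Mon]) (auto simp: C)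
  have "card C \<le> j" if pos: "\<forall>c\<in>C. 0 < expo c ?l"
  proof -
    have "p j \<notin> C" using pos pj_last by force
    then have "c \<le> p j \<and> c \<noteq> p j" if "c \<in> C" for c
      using C_down[OF that, of "p j"] p_Mon[of j] p_le[of 0 j] p0 that
      by (metis linear order_refl zero_le)
    then have "C \<subseteq> p ` {..j} - {p j}" using interval C by blast
    also have "\<dots> \<subseteq> p ` {..<j}" by (auto simp: less_le)
    finally have "card C \<le> card (p ` {..<j})" by (intro card_mono) auto
    also have "\<dots> \<le> j" using card_image_le[of "{..<j}" p] by simp
    finally show ?thesis .
  qed
  moreover have "0 < expo c ?l" if card: "card C \<le> j" and c: "c \<in> C" for c
  proof (rule ccontr)
    assume "\<not> ?thesis"
    then have c0: "expo c ?l = 0" by simp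
    have "p j \<le> c"
    proof (rule ccontr)
      assume "\<not> ?thesis"
      then have "c \<le> p j" by simp
      with interval[of c] c obtain s where "s \<le> j" "c = p s" by (auto simp: C)
      moreover from this have "s = j" using c0 neq by (simp add: expo_p)
      ultimately show False using \<open>\<not> p j \<le> c\<close> by simp
    qed
    then have "p s \<in> C" if "s \<le> j" for s
      using that p_le[of s j] p_le[of 0 s] p0 by (intro C_down[OF c] p_Mon) auto
    then have "p ` {..j} \<subseteq> C" by blast
    then have "card (p ` {..j}) \<le> card C" by (intro card_mono fin)
    with card show False by (simp add: card_image[OF inj])
  qed
  ultimately show ?thesis unfolding j_def by blast
qed

section \<open>Monomial ideals\<close>

lemma scalar_mult_mpoly_of: "scalar_mult c (mpoly_of w) = Poly_Mapping.single w c"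
  by (simp add: scalar_mult_def mpoly_of_def mult_single)

lemma lookup_scalar_mult:
  "Poly_Mapping.lookup (scalar_mult c p) w = c * Poly_Mapping.lookup p w"
  by (simp add: scalar_mult_def map.rep_eq when_def flip: mult_map_scale_conv_mult)

lemma mpoly_eq_sum:
  "p = (\<Sum>w\<in>Poly_Mapping.keys p. scalar_mult (Poly_Mapping.lookup p w) (mpoly_of w))"
  by (rule poly_mapping_eqI)
     (auto simp: scalar_mult_mpoly_of lookup_sum lookup_single when_def in_keys_iff)

lemma keys_mpoly_of: "Poly_Mapping.keys (mpoly_of w :: ('n, 'k::field) mpoly) = {w}"
  by (simp add: mpoly_of_def)

lemma mpoly_of_mult: "mpoly_of v * mpoly_of w = (mpoly_of (v + w) :: ('n, 'k::field) mpoly)"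
  by (simp add: mpoly_of_def mult_single)

lemma inj_mpoly_of: "inj (mpoly_of :: 'n monom \<Rightarrow> ('n, 'k::field) mpoly)"
  by (rule injI) (metis keys_mpoly_of singleton_inject)

lemma kspace_span_mpoly_of:
  "kspace.span (mpoly_of ` A) = {p :: ('n, 'k::field) mpoly. Poly_Mapping.keys p \<subseteq> A}"
proof (rule kspace.span_unique)
  show "kspace.subspace {p :: ('n, 'k) mpoly. Poly_Mapping.keys p \<subseteq> A}"
  proof (unfold kspace.subspace_def, intro conjI ballI allI)
    fix p q :: "('n, 'k) mpoly"
    assume "p \<in> {p. Poly_Mapping.keys p \<subseteq> A}" "q \<in> {p. Poly_Mapping.keys p \<subseteq> A}"
    then show "p + q \<in> {p. Poly_Mapping.keys p \<subseteq> A}" using keys_add[of p q] by blast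
  next
    fix c and p :: "('n, 'k) mpoly"
    assume "p \<in> {p. Poly_Mapping.keys p \<subseteq> A}"
    then show "scalar_mult c p \<in> {p. Poly_Mapping.keys p \<subseteq> A}"
      by (auto simp: in_keys_iff lookup_scalar_mult)
  qed simp
  fix T :: "('n, 'k) mpoly set" assume T: "mpoly_of ` A \<subseteq> T" "kspace.subspace T"
  show "{p. Poly_Mapping.keys p \<subseteq> A} \<subseteq> T"
  proof
    fix p :: "('n, 'k) mpoly" assume "p \<in> {p. Poly_Mapping.keys p \<subseteq> A}"
    then have "(\<Sum>w\<in>Poly_Mapping.keys p. scalar_mult (Poly_Mapping.lookup p w) (mpoly_of w)) \<in> T"
      using T by (intro kspace.subspace_sum kspace.subspace_scale) auto
    then show "p \<in> T" by (simp flip: mpoly_eq_sum)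
  qed
qed (simp add: keys_mpoly_of image_subset_iff)

lemma independent_mpoly_of: "kspace.independent (mpoly_of ` A :: ('n, 'k::field) mpoly set)"
proof
  assume "kspace.dependent (mpoly_of ` A :: ('n, 'k) mpoly set)"
  then obtain w where "w \<in> A" and
    *: "(mpoly_of w :: ('n, 'k) mpoly) \<in> kspace.span (mpoly_of ` A - {mpoly_of w})"
    unfolding kspace.dependent_def by blast
  have "mpoly_of ` A - {mpoly_of w} = (mpoly_of ` (A - {w}) :: ('n, 'k) mpoly set)"
    by (auto simp: inj_eq[OF inj_mpoly_of])
  with * show False by (simp add: kspace_span_mpoly_of keys_mpoly_of)
qed

text \<open>A polynomial lies in a monomial ideal if and only if all its monomials do.\<close>

lemma monomial_ideal_eq:
  "monomial_ideal L =
     {p :: ('n, 'k::field) mpoly. \<forall>w\<in>Poly_Mapping.keys p. \<exists>m. \<exists>l\<in>L. w = m + l}"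
  (is "_ = ?J")
  unfolding monomial_ideal_def
proof (rule ideal.span_unique)
  show "mpoly_of ` L \<subseteq> ?J"
    by (auto simp: keys_mpoly_of) (metis add_0)
  show "ideal.subspace ?J"
    unfolding ideal.subspace_def
  proof (intro conjI ballI allI)
    fix p q :: "('n, 'k) mpoly" assume "p \<in> ?J" "q \<in> ?J"
    then show "p + q \<in> ?J" using keys_add[of p q] by blast
  next
    fix c p :: "('n, 'k) mpoly" assume p: "p \<in> ?J"
    show "c * p \<in> ?J"
    proof (clarify)
      fix w assume "w \<in> Poly_Mapping.keys (c * p)"
      then obtain a b where "b \<in> Poly_Mapping.keys p" "w = a + b" using keys_mult by blast
      moreover from p this(1) obtain m l where "l \<in> L" "b = m + l" by blast
      ultimately have "l \<in> L" "w = (a + m) + l" by (simp_all add: add.assoc)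
      then show "\<exists>m. \<exists>l\<in>L. w = m + l" by blast
    qed
  qed simp
next
  fix T :: "('n, 'k) mpoly set" assume T: "mpoly_of ` L \<subseteq> T" "ideal.subspace T"
  show "?J \<subseteq> T"
  proof
    fix p assume p: "p \<in> ?J"
    have "scalar_mult (Poly_Mapping.lookup p w) (mpoly_of w) \<in> T" if "w \<in> Poly_Mapping.keys p" for w
    proof -
      from p that obtain m l where l: "l \<in> L" "w = m + l" by blast
      then have "scalar_mult (Poly_Mapping.lookup p w) (mpoly_of w) =
          Poly_Mapping.single m (Poly_Mapping.lookup p w) * mpoly_of l"
        by (simp add: scalar_mult_def mpoly_of_def mult_single)
      with l T show ?thesis by (auto intro!: ideal.subspace_scale)
    qed
    then have "(\<Sum>w\<in>Poly_Mapping.keys p. scalar_mult (Poly_Mapping.lookup p w) (mpoly_of w)) \<in> T"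
      by (intro ideal.subspace_sum T)
    then show "p \<in> T" by (simp flip: mpoly_eq_sum)
  qed
qed

lemma mpoly_of_mem_monomial_ideal:
  "(mpoly_of w :: ('n, 'k::field) mpoly) \<in> monomial_ideal L \<longleftrightarrow> (\<exists>m. \<exists>l\<in>L. w = m + l)"
  by (simp add: monomial_ideal_eq keys_mpoly_of)

lemma hom_component_monomial_ideal:
  assumes "L \<subseteq> Mon d"
  shows "hom_component d (monomial_ideal L) =
    kspace.span (mpoly_of ` L :: ('n::finite, 'k::field) mpoly set)"
proof -
  define P where "P w \<longleftrightarrow> (\<exists>m. \<exists>l\<in>L. w = m + l)" for w
  have "w \<in> L" if "w \<in> Mon d" "P w" for w
  proof -
    from that obtain m l where *: "w \<in> Mon d" "l \<in> L" "w = m + l" unfolding P_def by blast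
    then have "l \<in> Mon d" using assms by blast
    with * have "mdeg m = 0" by (simp add: Mon_def mdeg_add)
    with * show "w \<in> L" by (simp add: mdeg_eq_0_iff)
  qed
  moreover have "P w" if "w \<in> L" for w
    unfolding P_def by (rule exI[of _ 0], rule bexI[OF _ that]) simp
  moreover have "hom_component d (monomial_ideal L) =
      {p :: ('n, 'k) mpoly. (\<forall>w\<in>Poly_Mapping.keys p. P w) \<and> Poly_Mapping.keys p \<subseteq> Mon d}"
    by (simp add: hom_component_def monomial_ideal_eq P_def)
  ultimately show ?thesis
    using assms unfolding kspace_span_mpoly_of by blast
qed

lemma hilbert_function_monomial_ideal:
  assumes "L \<subseteq> Mon d"
  shows "hilbert_function (monomial_ideal L :: ('n::finite, 'k::field) mpoly set) d = card L"
  unfolding hilbert_function_def hom_component_monomial_ideal[OF assms]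
    kspace.dim_span_eq_card_independent[OF independent_mpoly_of]
  by (rule card_image) (rule inj_on_subset[OF inj_mpoly_of subset_UNIV])

text \<open>Scalars are polynomials, so an ideal is also a vector subspace.\<close>

lemma ideal_span_kspace_span: "ideal.span (kspace.span B) = ideal.span B"
proof -
  have "kspace.span B \<subseteq> ideal.span B"
    by (rule kspace.span_minimal[OF ideal.span_superset])
       (auto simp: kspace.subspace_def scalar_mult_def
          intro: ideal.span_add ideal.span_scale ideal.span_zero)
  then show ?thesis
    by (metis ideal.span_mono ideal.span_span kspace.span_superset subset_antisym)
qed

lemma generated_in_degree_monomial_ideal:
  assumes "L \<subseteq> Mon d"
  shows "generated_in_degree d (monomial_ideal L)"
  unfolding generated_in_degree_def hom_component_monomial_ideal[OF assms] ideal_span_kspace_span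
  by (simp add: monomial_ideal_def)

lemma ideal_mult_span_span:
  "ideal_mult (ideal.span A) (ideal.span B) = ideal.span {f * g | f g. f \<in> A \<and> g \<in> B}"
    (is "_ = ideal.span ?P")
  unfolding ideal_mult_def
proof (rule subset_antisym)
  have 1: "f * g \<in> ideal.span ?P" if "f \<in> A" "g \<in> ideal.span B" for f g
    using that(2)
  proof (induction rule: ideal.span_induct_alt)
    case (step c x y)
    have "f * x \<in> ideal.span ?P" using \<open>f \<in> A\<close> step(1) by (intro ideal.span_base) blast
    from ideal.span_add[OF ideal.span_scale[OF this] step(2)]
    have "c * (f * x) + f * y \<in> ideal.span ?P" .
    then show ?case by (simp only: distrib_left mult.left_commute)
  qed (simp add: ideal.span_zero)
  have "f * g \<in> ideal.span ?P" if "f \<in> ideal.span A" "g \<in> ideal.span B" for f g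
    using that(1)
  proof (induction rule: ideal.span_induct_alt)
    case (step c x y)
    from ideal.span_add[OF ideal.span_scale[OF 1[OF step(1) that(2)]] step(2)]
    have "c * (x * g) + y * g \<in> ideal.span ?P" .
    then show ?case by (simp only: distrib_right mult.assoc)
  qed (simp add: ideal.span_zero)
  then show "ideal.span {f * g | f g. f \<in> ideal.span A \<and> g \<in> ideal.span B} \<subseteq> ideal.span ?P"
    by (intro ideal.span_minimal) auto
  show "ideal.span ?P \<subseteq> ideal.span {f * g | f g. f \<in> ideal.span A \<and> g \<in> ideal.span B}"
    by (intro ideal.span_mono) (blast intro: ideal.span_base)
qed

lemma ideal_mult_irrelevant_ideal:
  "ideal_mult irrelevant_ideal (monomial_ideal L) =
     (monomial_ideal (shadow L) :: ('n, 'k::field) mpoly set)"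
proof -
  have "{f * g | f g. f \<in> range (\<lambda>i. mpoly_of (var i)) \<and> g \<in> mpoly_of ` L} =
      (mpoly_of ` shadow L :: ('n, 'k) mpoly set)"
      (is "?lhs = _")
  proof -
    have "?lhs = {mpoly_of (var i) * mpoly_of w | i w. w \<in> L}" by blast
    also have "\<dots> = {mpoly_of (var i + w) | i w. w \<in> L}" by (simp only: mpoly_of_mult)
    also have "\<dots> = mpoly_of ` shadow L" unfolding shadow_def by blast
    finally show ?thesis .
  qed
  then show ?thesis
    unfolding irrelevant_ideal_def monomial_ideal_def ideal_mult_span_span by (simp only:)
qed

text \<open>This is graded Nakayama in elementary form.  No element of the ideal has terms of degree less than
  \<open>d\<close>, so in a combination of elements \<open>g\<close> of a generating set \<open>G\<close> only the constant terms of the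
  coefficients contribute to degree \<open>d\<close>.  Hence the projections of the elements of \<open>G\<close> to degree \<open>d\<close>
  span a vector space that contains the linearly independent monomials of \<open>A\<close>.\<close>

lemma num_generators_monomial_ideal:
  fixes A :: "'n::finite monom set"
  assumes "finite A" and "A \<subseteq> Mon d"
  shows "num_generators (monomial_ideal A :: ('n, 'k::field) mpoly set) = card A"
  unfolding num_generators_def
proof (rule Least_equality)
  have "card (mpoly_of ` A :: ('n, 'k) mpoly set) = card A"
    by (rule card_image) (rule inj_on_subset[OF inj_mpoly_of subset_UNIV])
  then show "\<exists>G :: ('n, 'k) mpoly set. finite G \<and> card G = card A \<and> ideal.span G = monomial_ideal A"
    using assms(1) by (intro exI[of _ "mpoly_of ` A"]) (simp add: monomial_ideal_def)
next
  fix m assume "\<exists>G :: ('n, 'k) mpoly set. finite G \<and> card G = m \<and> ideal.span G = monomial_ideal A"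
  then obtain G :: "('n, 'k) mpoly set"
    where G: "finite G" "card G = m" "ideal.span G = monomial_ideal A" by blast
  \<comment> \<open>Projecting to the span of \<open>A\<close> is the same on the ideal as projecting to degree \<open>d\<close>.\<close>
  define proj :: "('n, 'k) mpoly \<Rightarrow> ('n, 'k) mpoly"
    where "proj p = (\<Sum>w\<in>A. scalar_mult (Poly_Mapping.lookup p w) (mpoly_of w))" for p
  have proj_add: "proj (p + q) = proj p + proj q" for p q
    by (simp add: proj_def lookup_add kspace.scale_left_distrib sum.distrib)
  have proj_mult: "proj (c * g) = scalar_mult (Poly_Mapping.lookup c 0) (proj g)"
    if "g \<in> G" for c g
  proof -
    \<comment> \<open>The part of the coefficient without its constant term raises degrees above \<open>d\<close>.\<close>
    define c' where "c' = c - Poly_Mapping.single 0 (Poly_Mapping.lookup c 0)"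
    have "Poly_Mapping.lookup (c' * g) w = 0" if "w \<in> A" for w
    proof (rule ccontr)
      assume "\<not> ?thesis"
      then obtain a b where a: "a \<in> Poly_Mapping.keys c'" and b: "b \<in> Poly_Mapping.keys g"
        and w: "w = a + b"
        using keys_mult[of c' g] by (force simp: in_keys_iff)
      have "g \<in> monomial_ideal A" using G(3) \<open>g \<in> G\<close> ideal.span_base by blast
      with b obtain m l where "l \<in> A" "b = m + l" unfolding monomial_ideal_eq by blast
      moreover from this have "mdeg l = d" "mdeg w = d"
        using \<open>w \<in> A\<close> assms(2) by (auto simp: Mon_def)
      ultimately have "mdeg a = 0" by (simp add: w mdeg_add)
      then have "a = 0" by (simp add: mdeg_eq_0_iff)
      with a show False by (simp add: c'_def in_keys_iff lookup_minus)
    qed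
    moreover have "c * g = scalar_mult (Poly_Mapping.lookup c 0) g + c' * g"
      by (simp add: c'_def scalar_mult_def algebra_simps)
    ultimately have "Poly_Mapping.lookup (c * g) w =
        Poly_Mapping.lookup c 0 * Poly_Mapping.lookup g w" if "w \<in> A" for w
      using that by (simp add: lookup_add lookup_scalar_mult)
    then show ?thesis
      by (simp add: proj_def kspace.scale_sum_right)
  qed
  have span: "proj p \<in> kspace.span (proj ` G)" if "p \<in> ideal.span G" for p
    using that
  proof (induction rule: ideal.span_induct_alt)
    case base
    then show ?case by (simp add: proj_def kspace.span_zero)
  next
    case (step c x y)
    then show ?case
      by (simp add: proj_add proj_mult kspace.span_add kspace.span_scale kspace.span_base)
  qed
  have "mpoly_of w \<in> kspace.span (proj ` G)" if "w \<in> A" for w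
  proof -
    have "proj (mpoly_of w) = (\<Sum>w'\<in>{w}. scalar_mult 1 (mpoly_of w'))"
      unfolding proj_def
      by (rule sum.mono_neutral_cong_right)
         (use assms(1) that in \<open>auto simp: mpoly_of_def lookup_single_not_eq\<close>)
    moreover have "mpoly_of w \<in> ideal.span G"
      using that by (simp add: G(3) monomial_ideal_def ideal.span_base)
    ultimately show ?thesis using span[of "mpoly_of w"] by simp
  qed
  then have "finite (mpoly_of ` A :: ('n, 'k) mpoly set) \<and>
      card (mpoly_of ` A :: ('n, 'k) mpoly set) \<le> card (proj ` G)"
    using G(1) by (intro kspace.independent_span_bound independent_mpoly_of) auto
  then have "card A \<le> card (proj ` G)"
    by (metis card_image inj_mpoly_of inj_on_subset subset_UNIV)
  also have "\<dots> \<le> m" using G(1,2) card_image_le by blast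
  finally show "card A \<le> m" .
qed

lemma hom_component_lex_ideal:
  "hom_component d (lex_ideal I) =
     kspace.span (mpoly_of ` init_lexsegment_of_card d (hilbert_function I d)
       :: ('n::{finite,linorder}, 'k::field) mpoly set)"
proof -
  have "w \<in> init_lexsegment_of_card d (hilbert_function I d)"
    if "w \<in> init_lexsegment_of_card j (hilbert_function I j)" "w \<in> Mon d" for w :: "'n monom" and j
  proof -
    have "j = d" using that by (simp add: init_lexsegment_of_card_def Mon_def)
    with that show ?thesis by simp
  qed
  moreover have "init_lexsegment_of_card d k \<subseteq> Mon d" for k
    by (auto simp: init_lexsegment_of_card_def)
  ultimately show ?thesis
    unfolding lex_ideal_def hom_component_def image_UN[symmetric] kspace_span_mpoly_of by blast
qed

lemma gotzmann_ideal_monomial_ideal: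
  fixes L :: "'n::{finite,linorder} monom set"
  assumes "L \<subseteq> Mon d"
  shows "gotzmann_ideal d (monomial_ideal L :: ('n, 'k::field) mpoly set) \<longleftrightarrow>
    card (shadow L) = card (shadow (init_lexsegment_of_card d (card L) :: 'n monom set))"
proof -
  have num: "num_generators (ideal_mult irrelevant_ideal (monomial_ideal K) :: ('n, 'k) mpoly set)
      = card (shadow K)" if "K \<subseteq> Mon d" for K :: "'n monom set"
    unfolding ideal_mult_irrelevant_ideal
    using shadow_subset_Mon[OF that] finite_Mon
    by (intro num_generators_monomial_ideal[of _ "Suc d"]) (auto intro: finite_subset)
  have "ideal.span (hom_component d (lex_ideal (monomial_ideal L :: ('n, 'k) mpoly set))) =
      monomial_ideal (init_lexsegment_of_card d (card L))"
    unfolding hom_component_lex_ideal hilbert_function_monomial_ideal[OF assms]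
      ideal_span_kspace_span by (simp add: monomial_ideal_def)
  moreover have "init_lexsegment_of_card d (card L) \<subseteq> (Mon d :: 'n monom set)"
    by (auto simp: init_lexsegment_of_card_def)
  ultimately show ?thesis
    unfolding gotzmann_ideal_def
    by (simp add: generated_in_degree_monomial_ideal[OF assms] num assms)
qed

text \<open>The degree of the generators is the least one in which the ideal is not zero, and its component
  there is spanned by them.\<close>

lemma monomial_ideal_eq_imp_eq:
  assumes "monomial_ideal L = (monomial_ideal K :: ('n::finite, 'k::field) mpoly set)"
    and "L \<subseteq> Mon d" "K \<subseteq> Mon e" "L \<noteq> {}" "K \<noteq> {}"
  shows "d = e" "L = K"
proof -
  have le: "e \<le> d" if eq: "monomial_ideal L = (monomial_ideal K :: ('n, 'k) mpoly set)"
    and LK: "L \<subseteq> Mon d" "K \<subseteq> Mon e" "L \<noteq> {}" for L K d e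
  proof -
    obtain l where "l \<in> L" using LK(3) by blast
    then have "(mpoly_of l :: ('n, 'k) mpoly) \<in> monomial_ideal L"
      unfolding monomial_ideal_def by (intro ideal.span_base imageI)
    then obtain m k where "k \<in> K" "l = m + k" by (auto simp: eq mpoly_of_mem_monomial_ideal)
    moreover from this have "mdeg k = e" "mdeg l = d"
      using LK \<open>l \<in> L\<close> by (auto simp: Mon_def)
    ultimately show ?thesis by (auto simp: mdeg_add)
  qed
  show "d = e" using le[of L K d e] le[of K L e d] assms by auto
  then have "kspace.span (mpoly_of ` L) = kspace.span (mpoly_of ` K :: ('n, 'k) mpoly set)"
    using assms(1-3) hom_component_monomial_ideal by metis
  then have "\<And>p :: ('n, 'k) mpoly. Poly_Mapping.keys p \<subseteq> L \<longleftrightarrow> Poly_Mapping.keys p \<subseteq> K"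
    by (auto simp: kspace_span_mpoly_of)
  from this[of "mpoly_of _"] show "L = K" by (auto simp: keys_mpoly_of)
qed

section \<open>Completely lexsegment ideals that are Gotzmann\<close>

lemma finite_lexsegment: "finite (lexsegment d u v)"
  by (rule finite_subset[OF _ finite_Mon]) (auto simp: lexsegment_def)

text \<open>A completely lexsegment ideal may a priori be generated by a completely lexsegment set other than \<open>L\<close>,
  but the ideal determines its set of generators of one degree.\<close>

lemma completely_lexsegment_ideal_shadow:
  fixes L :: "'n::{finite,linorder} monom set"
  assumes "completely_lexsegment_ideal (monomial_ideal L :: ('n, 'k::field) mpoly set)"
    and "L \<subseteq> Mon d" and "L \<noteq> {}"
  shows "is_lexsegment_set (Suc d) (shadow L)"
proof -
  obtain e K where K: "completely_lexsegment_set e K"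
    and eq: "monomial_ideal L = (monomial_ideal K :: ('n, 'k) mpoly set)"
    using assms(1) by (auto simp: completely_lexsegment_ideal_def)
  from K have lex: "is_lexsegment_set (e + i) ((shadow ^^ i) K)" for i
    by (simp add: completely_lexsegment_set_def)
  from lex[of 0] obtain u' v' where "u' \<in> Mon e" "v' \<le> u'" "K = lexsegment e u' v'"
    by (auto simp: is_lexsegment_set_def)
  then have "K \<subseteq> Mon e" "K \<noteq> {}" by (auto simp: lexsegment_def)
  with monomial_ideal_eq_imp_eq[OF eq assms(2) _ assms(3)] have "d = e" "L = K" by auto
  with lex[of 1] show ?thesis by simp
qed

text \<open>A lexsegment is determined by its greatest and its least element, and those of the shadow are
  \<open>x\<^sub>1 u\<close> and \<open>x\<^sub>n v\<close>.\<close>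

lemma shadow_lexsegment_eq:
  assumes "is_lexsegment_set (Suc d) (shadow (lexsegment d u v))"
    and "u \<in> Mon d" and "v \<in> Mon d" and "v \<le> u"
  shows "shadow (lexsegment d u v) = lexsegment (Suc d) (var first_var + u) (var last_var + v)"
proof -
  let ?S = "shadow (lexsegment d u v)"
  obtain s t where s: "s \<in> Mon (Suc d)" and t: "t \<in> Mon (Suc d)" and "t \<le> s"
    and S: "?S = lexsegment (Suc d) s t"
    using assms(1) unfolding is_lexsegment_set_def by blast
  have bounds: "w \<le> var first_var + u \<and> var last_var + v \<le> w" if "w \<in> ?S" for w
  proof -
    from that obtain i x where "w = var i + x" "x \<le> u" "v \<le> x"
      unfolding shadow_def lexsegment_def by blast
    moreover have "var i \<le> var first_var" "var last_var \<le> var i"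
      by (simp_all only: var_le_var_iff first_var_le le_last_var)
    ultimately show ?thesis by (metis add_mono)
  qed
  have "u \<in> lexsegment d u v" "v \<in> lexsegment d u v" using assms by (auto simp: lexsegment_def)
  then have "var first_var + u \<in> ?S" "var last_var + v \<in> ?S" unfolding shadow_def by blast+
  then have "var first_var + u \<le> s" "t \<le> var last_var + v"
    unfolding S by (simp_all add: lexsegment_def)
  moreover have "s \<in> ?S" "t \<in> ?S"
    using s t \<open>t \<le> s\<close> unfolding S by (simp_all add: lexsegment_def)
  ultimately have "s = var first_var + u" "t = var last_var + v"
    using bounds by (meson antisym)+
  with S show ?thesis by simp
qed

lemma expo_first_var_pos_mono:
  assumes "v \<le> w" and "0 < expo v first_var"
  shows "0 < expo w first_var"
proof (cases "v = w")
  case False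
  then obtain i where i: "expo v i < expo w i" "\<forall>l<i. expo v l = expo w l"
    using assms(1) monom_less_iff_lex[of v w] by auto
  show ?thesis
  proof (cases "i = first_var")
    case False
    then have "first_var < i" using first_var_le[of i] by simp
    then show ?thesis using i(2) assms(2) by simp
  qed (use i(1) in simp)
qed (use assms in simp)

text \<open>A monomial above \<open>x\<^sub>1 u\<close> is divisible by \<open>x\<^sub>1\<close>, so the monomials of degree \<open>d + 1\<close> above \<open>x\<^sub>1 u\<close>
  correspond to those of degree \<open>d\<close> above \<open>u\<close>.\<close>

lemma card_shadow_init_lexsegment:
  assumes "is_lexsegment_set (Suc d) (shadow (lexsegment d u v))"
    and "u \<in> Mon d" and "v \<in> Mon d" and "v \<le> u"
  shows "card (shadow (init_lexsegment d v)) =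
    card (shadow (lexsegment d u v)) + card {w \<in> Mon d. u < w}"
proof -
  let ?U = "{w \<in> Mon d. u < w}"
  note S = shadow_lexsegment_eq[OF assms]
  have "shadow (init_lexsegment d v) = shadow (lexsegment d u v) \<union> (+) (var first_var) ` ?U"
    (is "?B = ?L \<union> ?T")
  proof (intro subset_antisym subsetI)
    fix w assume "w \<in> ?B"
    then obtain i x where w: "w = var i + x" and x: "x \<in> Mon d" "v \<le> x"
      unfolding shadow_def init_lexsegment_def by blast
    have "var last_var \<le> var i" by (simp only: var_le_var_iff le_last_var)
    then have low: "var last_var + v \<le> w" unfolding w using x(2) by (rule add_mono)
    have deg: "w \<in> Mon (Suc d)" using x(1) by (simp add: w Mon_def mdeg_add mdeg_single)
    show "w \<in> ?L \<union> ?T"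
    proof (cases "w \<le> var first_var + u")
      case True
      with low deg have "w \<in> ?L" unfolding S by (simp add: lexsegment_def)
      then show ?thesis by blast
    next
      case False
      then have gt: "var first_var + u < w" by simp
      have "0 < expo w first_var"
        by (rule expo_first_var_pos_mono[OF less_imp_le[OF gt]]) (simp add: lookup_add)
      then have eq: "w = var first_var + (w - var first_var)" (is "_ = _ + ?y")
        by (rule var_dvd_monom)
      have "u < ?y" using gt by (subst (asm) eq) (simp only: add_less_cancel_left)
      moreover have "?y \<in> Mon d"
        using arg_cong[OF eq, of mdeg] deg by (simp add: Mon_def mdeg_add mdeg_single)
      ultimately have "w \<in> ?T" by (subst eq) blast
      then show ?thesis by blast
    qed
  next
    fix w assume "w \<in> ?L \<union> ?T"
    moreover have "?L \<subseteq> ?B"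
      unfolding shadow_def lexsegment_def init_lexsegment_def by blast
    moreover have "?U \<subseteq> init_lexsegment d v"
      using assms(4) by (auto simp: init_lexsegment_def)
    then have "?T \<subseteq> ?B" unfolding shadow_def by blast
    ultimately show "w \<in> ?B" by blast
  qed
  moreover have "?L \<inter> ?T = {}" unfolding S by (auto simp: lexsegment_def)
  moreover have "finite ?L" unfolding S by (rule finite_lexsegment)
  moreover have "finite ?T" by (intro finite_imageI) (simp add: finite_Mon)
  ultimately have "card ?B = card ?L + card ?T" by (simp only: card_Un_disjoint)
  moreover have "card ?T = card ?U" by (rule card_image) simp
  ultimately show ?thesis by simp
qed

theorem theorem8:
  fixes u v :: "'n::{finite,linorder} monom"
    and d j a :: nat
    and I :: "('n, 'k::field) mpoly set"
  assumes "u \<in> Mon d" and "v \<in> Mon d" and "u \<ge> v"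
    and "0 < Poly_Mapping.lookup u first_var"
    and "I = monomial_ideal (lexsegment d u v)"
    and "completely_lexsegment_ideal I"
    and "\<not> init_lexsegment_ideal I"
    and "j = Poly_Mapping.lookup v last_var"
    and "a = card (Mon d - init_lexsegment d u)"
  shows "gotzmann_ideal d I \<longleftrightarrow>
    int a \<ge> int ((CARD('n) + d - 1) choose d) - (int j + 1)"
proof -
  let ?L = "lexsegment d u v"
  let ?U = "{w \<in> Mon d. u < w}"
  define B where "B = init_lexsegment d v"
  define A :: "'n monom set" where "A = init_lexsegment_of_card d (card ?L)"
  define m where "m = card ?U"
  have "?L \<subseteq> Mon d" "?L \<noteq> {}" using assms(1,3) by (auto simp: lexsegment_def)
  then have lex: "is_lexsegment_set (Suc d) (shadow ?L)"
    using assms(5,6) by (intro completely_lexsegment_ideal_shadow[where 'k = 'k]) simp_all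
  have "0 < d"
  proof (rule ccontr)
    assume "\<not> 0 < d"
    then have "u = 0" using assms(1) by (simp add: Mon_def mdeg_eq_0_iff)
    with assms(4) show False by simp
  qed

  have init: "initial_segment d A" "initial_segment d B"
    by (simp_all add: A_def B_def initial_segment_init_lexsegment
        initial_segment_init_lexsegment_of_card)
  have card_A: "card A = card ?L"
    unfolding A_def init_lexsegment_of_card_def
    using card_mono[OF finite_Mon \<open>?L \<subseteq> Mon d\<close>] by (intro card_top_elements finite_Mon)
  have "B = ?L \<union> ?U" "?L \<inter> ?U = {}"
    using assms(3) by (auto simp: B_def init_lexsegment_def lexsegment_def)
  then have card_B: "card B = card ?L + m"
    by (simp add: card_Un_disjoint finite_lexsegment finite_Mon m_def)
  have "A \<subseteq> B" using init card_A card_B by (intro initial_segment_subset_of_card_le) simp_all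
  have "A \<subseteq> Mon d" "B \<subseteq> Mon d" using init by (simp_all add: initial_segment_def)
  then have "finite A" "finite B" by (simp_all add: finite_subset[OF _ finite_Mon])
  then have card_C: "card (B - A) = m"
    using \<open>A \<subseteq> B\<close> card_A card_B by (simp add: card_Diff_subset)

  have "gotzmann_ideal d I \<longleftrightarrow> card (shadow ?L) = card (shadow A)"
    unfolding assms(5) A_def
    using gotzmann_ideal_monomial_ideal[OF \<open>?L \<subseteq> Mon d\<close>] by blast
  also have "\<dots> \<longleftrightarrow> card (shadow B) = card (shadow A) + card (B - A)"
    using card_shadow_init_lexsegment[OF lex assms(1-3)]
    unfolding card_C unfolding B_def m_def by auto
  also have "\<dots> \<longleftrightarrow> (\<forall>c\<in>B - A. 0 < expo c last_var)"
    by (rule card_shadow_eq_iff[OF init \<open>A \<subseteq> B\<close> \<open>0 < d\<close>])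
  also have "\<dots> \<longleftrightarrow> m \<le> j"
  proof (cases "m = 0")
    case True
    then have "B - A = {}" using card_C \<open>finite B\<close> by simp
    with True show ?thesis by auto
  next
    case False
    \<comment> \<open>In one variable there is no second monomial of the same degree above \<open>u\<close>.\<close>
    then obtain w where "w \<in> Mon d" "u < w" unfolding m_def by (auto simp: card_gt_0_iff)
    then obtain i where i: "expo u i < expo w i" by (auto simp: monom_less_iff_lex)
    have "(first_var :: 'n) \<noteq> last_var"
    proof
      assume "(first_var :: 'n) = last_var"
      then have "x = i" for x :: 'n
        using first_var_le[of x] le_last_var[of x] first_var_le[of i] le_last_var[of i] by simp
      then have univ: "(UNIV :: 'n set) = {i}" by auto
      have "mdeg x = expo x i" for x unfolding mdeg_def univ by simp
      then have "expo u i = d" "expo w i = d"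
        using assms(1) \<open>w \<in> Mon d\<close> by (simp_all add: Mon_def)
      with i show False by simp
    qed
    with card_last_interval_iff[OF assms(2) init(1)] show ?thesis
      by (simp add: B_def card_C[unfolded B_def] assms(8))
  qed
  also have "\<dots> \<longleftrightarrow> int a \<ge> int ((CARD('n) + d - 1) choose d) - (int j + 1)"
  proof -
    have sub: "init_lexsegment d u \<subseteq> Mon d" by (auto simp: init_lexsegment_def)
    have "init_lexsegment d u = insert u ?U" using assms(1) by (auto simp: init_lexsegment_def)
    then have "card (init_lexsegment d u) = m + 1" by (simp add: m_def finite_Mon)
    moreover have "card (Mon d :: 'n monom set) = a + card (init_lexsegment d u)"
      using card_mono[OF finite_Mon sub] finite_subset[OF sub finite_Mon]
      by (simp add: assms(9) card_Diff_subset sub)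
    ultimately show ?thesis by (simp add: card_Mon)
  qed
  finally show ?thesis .
qed

end
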